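(* Let $(L,A,\mathfrak m,\ell)$ be a left-symmetric Rinehart algebra over a field $\mathbb K$ of characteristic zero and let $\mathfrak m_t=\sum_{i\ge0}t^i\mathfrak m_i$ be a deformation of it. Then the infinitesimal $\mathfrak m_1$ is a 2-cocycle in $\mathfrak D^1(L)$, i.e. $\delta(\mathfrak m_1)=0$. More generally, if $n\ge1$, $\mathfrak m_i=0$ for $1\le i\le n-1$ and $\mathfrak m_n\neq0$, then the $n$-infinitesimal $\mathfrak m_n$ is a 2-cocycle, i.e. $\delta(\mathfrak m_n)=0$.
   Context: All vector spaces are over a field $\mathbb K$ of characteristic zero. A left-symmetric Rinehart algebra is a quadruple $(L,A,\mathfrak m,\ell)$ where $A$ is an associative commutative $\mathbb K$-algebra, $L$ is an $A$-module with a bilinear product $\mathfrak m(x,y)=x\cdot y$ satisfying $(x\cdot y)\cdot z-x\cdot(y\cdot z)=(y\cdot x)\cdot z-y\cdot(x\cdot z)$, and $\ell:L\to \mathrm{Der}(A)$ is a linear map such that $\ell(x\cdot y-y\cdot x)=\ell(x)\ell(y)-\ell(y)\ell(x)$, $\ell(ax)=a\ell(x)$, $x\cdot(ay)=\ell(x)(a)\,y+a(x\cdot y)$, and $(ax)\cdot y=a(x\cdot y)$ for all $a\in A$, $x,y,z\in L$. Write $[x,y]=x\cdot y-y\cdot x$. $\mathfrak D^1(L)$ is the space of $\mathbb K$-bilinear maps $P:L\otimes L\to L$ with $P(ax,y)=aP(x,y)$ and $P(x,ay)=aP(x,y)+\Xi_P(x)(a)y$ for a map $\Xi_P:L\to\mathrm{Der}(A)$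 (the symbol). For $P\in\mathfrak D^1(L)$ the coboundary is $$\delta P(x,y,z)=x\cdot P(y,z)-y\cdot P(x,z)+P(y,x)\cdot z-P(x,y)\cdot z-P(y,x\cdot z)+P(x,y\cdot z)-P([x,y],z).$$ A deformation of $(L,A,\mathfrak m,\ell)$ is a $\mathbb K[[t]]$-bilinear map $\mathfrak m_t:L[[t]]\otimes L[[t]]\to L[[t]]$, $\mathfrak m_t(x,y)=\sum_{i\ge0}t^i\mathfrak m_i(x,y)$ for $x,y\in L$, with $\mathfrak m_0=\mathfrak m$ and $\mathfrak m_i\in\mathfrak D^1(L)$, satisfying the left-symmetric identity $\mathfrak m_t(\mathfrak m_t(x,y),z)-\mathfrak m_t(x,\mathfrak m_t(y,z))=\mathfrak m_t(\mathfrak m_t(y,x),z)-\mathfrak m_t(y,\mathfrak m_t(x,z))$. *)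

theory Defs
  imports "HOL-Computational_Algebra.Formal_Power_Series"
begin

definition bilinear_maps ::
  "('r::comm_ring_1 \<Rightarrow> 'v::ab_group_add \<Rightarrow> 'v) \<Rightarrow> ('v \<Rightarrow> 'v \<Rightarrow> 'v) set" where
  "bilinear_maps s =
     {P. (\<forall>x. module_hom s s (P x)) \<and> (\<forall>y. module_hom s s (\<lambda>x. P x y))}"

definition Der :: "('k::field \<Rightarrow> 'a::comm_ring_1 \<Rightarrow> 'a) \<Rightarrow> ('a \<Rightarrow> 'a) set" where
  "Der sA = {D. Vector_Spaces.linear sA sA D \<and> (\<forall>a b. D (a * b) = D a * b + a * D b)}"

text \<open>\<open>sA\<close> and \<open>sL\<close> are the scalar multiplications of the ground field on the algebra and on \<open>L\<close>,
  \<open>act\<close> is the action of the algebra on \<open>L\<close>. The algebra is unital and \<open>L\<close> is a unital module;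
  \<open>act_scale\<close> says that the vector space structure of \<open>L\<close> is the one induced by its module
  structure.\<close>

locale left_symmetric_rinehart =
  A: vector_space sA + L: vector_space sL + AL: module act
  for sA :: "'k::field_char_0 \<Rightarrow> 'a::comm_ring_1 \<Rightarrow> 'a"
    and sL :: "'k \<Rightarrow> 'l::ab_group_add \<Rightarrow> 'l"
    and act :: "'a \<Rightarrow> 'l \<Rightarrow> 'l" +
  fixes m :: "'l \<Rightarrow> 'l \<Rightarrow> 'l"
    and ell :: "'l \<Rightarrow> 'a \<Rightarrow> 'a"
  assumes scale_mult: "sA k (a * b) = sA k a * b"
    and act_scale: "act (sA k a) x = sL k (act a x)"
    and m_bilinear: "m \<in> bilinear_maps sL"
    and left_symmetric: "m (m x y) z - m x (m y z) = m (m y x) z - m y (m x z)"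
    and ell_Der: "ell x \<in> Der sA"
    and ell_linear: "Vector_Spaces.linear sL sA (\<lambda>x. ell x a)"
    and ell_commutator: "ell (m x y - m y x) a = ell x (ell y a) - ell y (ell x a)"
    and ell_act: "ell (act b x) a = b * ell x a"
    and m_act_right: "m x (act a y) = act (ell x a) y + act a (m x y)"
    and m_act_left: "m (act a x) y = act a (m x y)"

text \<open>The space \<open>\<DD>\<^sup>1(L)\<close>; \<open>\<Xi>\<close> is the symbol.\<close>

definition D1 ::
  "('k::field \<Rightarrow> 'a::comm_ring_1 \<Rightarrow> 'a) \<Rightarrow> ('k \<Rightarrow> 'l::ab_group_add \<Rightarrow> 'l) \<Rightarrow>
   ('a \<Rightarrow> 'l \<Rightarrow> 'l) \<Rightarrow> ('l \<Rightarrow> 'l \<Rightarrow> 'l) set" where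
  "D1 sA sL act =
     {P. P \<in> bilinear_maps sL \<and>
         (\<forall>a x y. P (act a x) y = act a (P x y)) \<and>
         (\<exists>\<Xi>. (\<forall>x. \<Xi> x \<in> Der sA) \<and>
              (\<forall>a x y. P x (act a y) = act a (P x y) + act (\<Xi> x a) y))}"

definition coboundary ::
  "('l::ab_group_add \<Rightarrow> 'l \<Rightarrow> 'l) \<Rightarrow> ('l \<Rightarrow> 'l \<Rightarrow> 'l) \<Rightarrow> 'l \<Rightarrow> 'l \<Rightarrow> 'l \<Rightarrow> 'l" where
  "coboundary m P x y z =
     m x (P y z) - m y (P x z) + m (P y x) z - m (P x y) z
     - P y (m x z) + P x (m y z) - P (m x y - m y x) z"

definition two_cocycles ::
  "('k::field \<Rightarrow> 'a::comm_ring_1 \<Rightarrow> 'a) \<Rightarrow> ('k \<Rightarrow> 'l::ab_group_add \<Rightarrow> 'l) \<Rightarrow>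
   ('a \<Rightarrow> 'l \<Rightarrow> 'l) \<Rightarrow> ('l \<Rightarrow> 'l \<Rightarrow> 'l) \<Rightarrow> ('l \<Rightarrow> 'l \<Rightarrow> 'l) set" where
  "two_cocycles sA sL act m =
     {P \<in> D1 sA sL act. coboundary m P = (\<lambda>x y z. 0)}"

text \<open>\<open>L[[t]]\<close> is \<open>'l fps\<close>; \<open>fps_scale sL\<close> is its module structure over the ring \<open>'k fps\<close>.\<close>

definition fps_scale ::
  "('k::comm_ring_1 \<Rightarrow> 'l::ab_group_add \<Rightarrow> 'l) \<Rightarrow> 'k fps \<Rightarrow> 'l fps \<Rightarrow> 'l fps" where
  "fps_scale s f u = Abs_fps (\<lambda>n. \<Sum>i=0..n. s (fps_nth f i) (fps_nth u (n - i)))"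

lemma module_fps_scale:
  assumes "module s"
  shows "module (fps_scale s)"
proof -
  interpret module s by fact
  show ?thesis
  proof
    fix f g :: "'a fps" and u v :: "'b fps"
    show "fps_scale s f (u + v) = fps_scale s f u + fps_scale s f v"
      by (simp add: fps_eq_iff fps_scale_def scale_right_distrib sum.distrib)
    show "fps_scale s (f + g) u = fps_scale s f u + fps_scale s g u"
      by (simp add: fps_eq_iff fps_scale_def scale_left_distrib sum.distrib)
    show "fps_scale s 1 u = u"
    proof (rule fps_ext)
      fix n
      have "fps_nth (fps_scale s 1 u) n = (\<Sum>i=0..n. if i = 0 then fps_nth u n else 0)"
        unfolding fps_scale_def fps_nth_Abs_fps by (rule sum.cong) auto
      then show "fps_nth (fps_scale s 1 u) n = fps_nth u n" by simp
    qed
    show "fps_scale s f (fps_scale s g u) = fps_scale s (f * g) u"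
    proof (rule fps_ext)
      fix n
      have "fps_nth (fps_scale s (f * g) u) n =
          (\<Sum>j=0..n. \<Sum>i=0..j. s (fps_nth f i * fps_nth g (j - i)) (fps_nth u (n - j)))"
        by (simp add: fps_scale_def fps_mult_nth scale_sum_left)
      also have "\<dots> = (\<Sum>j=0..n. \<Sum>i=0..n - j. s (fps_nth f j * fps_nth g i) (fps_nth u (n - j - i)))"
        by (rule fps_mult_assoc_lemma)
      finally show "fps_nth (fps_scale s f (fps_scale s g u)) n = fps_nth (fps_scale s (f * g) u) n"
        by (simp add: fps_scale_def scale_sum_right)
    qed
  qed
qed

text \<open>\<open>deformation_coeff mt i\<close> is the map \<open>m\<^sub>i\<close> in the expansion of \<open>m\<^sub>t(x,y)\<close> for constant
  series \<open>x\<close>, \<open>y\<close>.\<close>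

definition deformation_coeff ::
  "('l::ab_group_add fps \<Rightarrow> 'l fps \<Rightarrow> 'l fps) \<Rightarrow> nat \<Rightarrow> 'l \<Rightarrow> 'l \<Rightarrow> 'l" where
  "deformation_coeff mt i x y = fps_nth (mt (fps_const x) (fps_const y)) i"

definition deformation ::
  "('k::field \<Rightarrow> 'a::comm_ring_1 \<Rightarrow> 'a) \<Rightarrow> ('k \<Rightarrow> 'l::ab_group_add \<Rightarrow> 'l) \<Rightarrow>
   ('a \<Rightarrow> 'l \<Rightarrow> 'l) \<Rightarrow> ('l \<Rightarrow> 'l \<Rightarrow> 'l) \<Rightarrow> ('l fps \<Rightarrow> 'l fps \<Rightarrow> 'l fps) \<Rightarrow> bool" where
  "deformation sA sL act m mt \<longleftrightarrow>
     mt \<in> bilinear_maps (fps_scale sL) \<and>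
     deformation_coeff mt 0 = m \<and>
     (\<forall>i. deformation_coeff mt i \<in> D1 sA sL act) \<and>
     (\<forall>x y z. mt (mt x y) z - mt x (mt y z) = mt (mt y x) z - mt y (mt x z))"

end

theory Submission
  imports Defs
begin

text \<open>A \<open>\<bbbK>[[t]]\<close>-linear map is automatically \<open>t\<close>-adically continuous, so \<open>m\<^sub>t\<close> is determined by its
  coefficients \<open>m\<^sub>i\<close>, and the left-symmetric identity says that
  \<open>\<Sum>\<^sub>i m\<^bsub>n-i\<^esub>(m\<^sub>i(x,y),z) - m\<^bsub>n-i\<^esub>(x,m\<^sub>i(y,z))\<close> is symmetric in \<open>x\<close>, \<open>y\<close> for each \<open>n\<close>. If \<open>m\<^sub>i = 0\<close> for
  \<open>0 < i < n\<close>, only the terms with \<open>i = 0\<close> and \<open>i = n\<close> survive, and they add up to \<open>\<delta>(m\<^sub>n) = 0\<close>.\<close>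

lemma fps_nth_fps_scale_X:
  assumes "module s"
  shows "fps_nth (fps_scale s fps_X u) n = (if n = 0 then 0 else fps_nth u (n - 1))"
proof -
  interpret module s by fact
  have "fps_nth (fps_scale s fps_X u) n = (\<Sum>i=0..n. if i = 1 then fps_nth u (n - 1) else 0)"
    unfolding fps_scale_def fps_nth_Abs_fps by (rule sum.cong) (auto simp: fps_X_def)
  then show ?thesis by auto
qed

lemma fps_const_add_scale_X_shift:
  assumes "module s"
  shows "u = fps_const (fps_nth u 0) + fps_scale s fps_X (fps_shift 1 u)"
  using assms by (auto simp: fps_eq_iff fps_nth_fps_scale_X)

text \<open>Peeling off the constant term of \<open>u\<close> shows that no coefficient of \<open>u\<close> beyond the \<open>n\<close>-th
  contributes.\<close>

lemma fps_nth_module_hom: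
  fixes s :: "'k::comm_ring_1 \<Rightarrow> 'l::ab_group_add \<Rightarrow> 'l"
  assumes s: "module s" and F: "module_hom (fps_scale s) (fps_scale s) F"
  shows "fps_nth (F u) n = (\<Sum>i=0..n. fps_nth (F (fps_const (fps_nth u i))) (n - i))"
proof (induction n arbitrary: u)
  interpret F: module_hom "fps_scale s" "fps_scale s" F by fact
  \<comment> \<open>\<open>F.scale\<close> is used with the scalar \<open>fps_X\<close>: linearity
    over power series, not just over the ground field, moves t outside \<open>F\<close>.\<close>
  have split: "F u = F (fps_const (fps_nth u 0)) + fps_scale s fps_X (F (fps_shift 1 u))" for u
    using arg_cong[OF fps_const_add_scale_X_shift[OF s, of u], of F]
    by (simp only: F.add F.scale)
  {
    case 0
    show ?case
      using arg_cong[OF split[of u], of "\<lambda>v. fps_nth v 0"]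
      by (simp add: fps_nth_fps_scale_X[OF s])
  next
    case (Suc n)
    \<comment> \<open>The factor t lowers the index by one, so the induction hypothesis applies to
      the shifted series; hence \<open>u\<close> is arbitrary in the induction.\<close>
    have "fps_nth (F u) (Suc n) =
        fps_nth (F (fps_const (fps_nth u 0))) (Suc n) + fps_nth (F (fps_shift 1 u)) n"
      using arg_cong[OF split[of u], of "\<lambda>v. fps_nth v (Suc n)"]
      by (simp add: fps_nth_fps_scale_X[OF s])
    then show ?case
      by (simp add: Suc.IH[of "fps_shift (Suc 0) u"] sum.atLeast0_atMost_Suc_shift del: sum.cl_ivl_Suc)
  }
qed

text \<open>Evaluating the left-symmetric identity on constant series leaves one argument of each
  outer product constant, so expanding the other one suffices.\<close>

lemma fps_nth_bilinear_left:
  assumes "module s" "mt \<in> bilinear_maps (fps_scale s)"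
  shows "fps_nth (mt u (fps_const z)) n = (\<Sum>i=0..n. deformation_coeff mt (n - i) (fps_nth u i) z)"
  unfolding deformation_coeff_def
  using assms by (intro fps_nth_module_hom[of s "\<lambda>u. mt u (fps_const z)"]) (auto simp: bilinear_maps_def)

lemma fps_nth_bilinear_right:
  assumes "module s" "mt \<in> bilinear_maps (fps_scale s)"
  shows "fps_nth (mt (fps_const x) u) n = (\<Sum>i=0..n. deformation_coeff mt (n - i) x (fps_nth u i))"
  unfolding deformation_coeff_def
  using assms by (intro fps_nth_module_hom[of s "mt (fps_const x)"]) (auto simp: bilinear_maps_def)

lemma sum_endpoints:
  fixes f :: "nat \<Rightarrow> 'b::comm_monoid_add"
  assumes "n \<ge> 1" and "\<And>i. 0 < i \<Longrightarrow> i < n \<Longrightarrow> f i = 0"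
  shows "(\<Sum>i=0..n. f i) = f 0 + f n"
proof -
  have "(\<Sum>i=0..n. f i) = (\<Sum>i\<in>{0, n}. f i)"
    by (rule sum.mono_neutral_right) (use assms in auto)
  \<comment> \<open>\<open>n \<ge> 1\<close> keeps the two endpoints distinct, so neither term is
    counted twice.\<close>
  then show ?thesis using assms(1) by simp
qed

lemma coboundary_n_infinitesimal:
  assumes L: "left_symmetric_rinehart sA sL act m ell"
    and def: "deformation sA sL act m mt"
    and n: "n \<ge> 1"
    and vanish: "\<And>i. 0 < i \<Longrightarrow> i < n \<Longrightarrow> deformation_coeff mt i = (\<lambda>x y. 0)"
  shows "coboundary m (deformation_coeff mt n) = (\<lambda>x y z. 0)"
proof (intro ext)
  fix x y z
  interpret left_symmetric_rinehart sA sL act m ell by fact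
  have s: "module sL" ..
  have bil: "mt \<in> bilinear_maps (fps_scale sL)"
    and m0: "deformation_coeff mt 0 = m"
    and ls: "\<And>u v w. mt (mt u v) w - mt u (mt v w) = mt (mt v u) w - mt v (mt u w)"
    using def by (auto simp: deformation_def)
  let ?P = "deformation_coeff mt n"
  have coeff0: "fps_nth (mt (fps_const a) (fps_const b)) i = deformation_coeff mt i a b" for a b i
    by (simp add: deformation_coeff_def)
  \<comment> \<open>The index 0 pairs the outer \<open>?P\<close> with the inner \<open>m\<close>;
    the index \<open>n\<close> pairs the outer \<open>m\<close> with the inner
    \<open>?P\<close>.\<close>
  have left: "fps_nth (mt (mt (fps_const a) (fps_const b)) (fps_const c)) n =
      ?P (m a b) c + m (?P a b) c" for a b c
    by (subst fps_nth_bilinear_left[OF s bil], subst sum_endpoints[OF n])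
      (simp_all add: vanish coeff0 m0)
  have right: "fps_nth (mt (fps_const a) (mt (fps_const b) (fps_const c))) n =
      ?P a (m b c) + m a (?P b c)" for a b c
    by (subst fps_nth_bilinear_right[OF s bil], subst sum_endpoints[OF n])
      (simp_all add: vanish coeff0 m0)
  have identity: "?P (m x y) z + m (?P x y) z - (?P x (m y z) + m x (?P y z)) =
      ?P (m y x) z + m (?P y x) z - (?P y (m x z) + m y (?P x z))"
    using arg_cong[OF ls[of "fps_const x" "fps_const y" "fps_const z"], of "\<lambda>u. fps_nth u n"]
    by (simp only: fps_sub_nth left right)
  have "module_hom sL sL (\<lambda>u. ?P u z)"
    using def by (auto simp: deformation_def D1_def bilinear_maps_def)
  then have "?P (m x y - m y x) z = ?P (m x y) z - ?P (m y x) z"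
    by (rule module_hom.diff)
  \<comment> \<open>Once the commutator term is split by additivity, the coboundary is the right
    side of \<open>identity\<close> minus its left side.\<close>
  then have "coboundary m ?P x y z =
      (?P (m y x) z + m (?P y x) z - (?P y (m x z) + m y (?P x z))) -
      (?P (m x y) z + m (?P x y) z - (?P x (m y z) + m x (?P y z)))"
    by (simp add: coboundary_def algebra_simps)
  also have "\<dots> = 0"
    by (simp only: identity diff_self)
  finally show "coboundary m ?P x y z = 0" .
qed

theorem proposition6p2:
  fixes sA :: "'k::field_char_0 \<Rightarrow> 'a::comm_ring_1 \<Rightarrow> 'a"
    and sL :: "'k \<Rightarrow> 'l::ab_group_add \<Rightarrow> 'l"
    and act :: "'a \<Rightarrow> 'l \<Rightarrow> 'l"
    and m :: "'l \<Rightarrow> 'l \<Rightarrow> 'l"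
    and ell :: "'l \<Rightarrow> 'a \<Rightarrow> 'a"
    and mt :: "'l fps \<Rightarrow> 'l fps \<Rightarrow> 'l fps"
  assumes "left_symmetric_rinehart sA sL act m ell"
    and "deformation sA sL act m mt"
  shows "deformation_coeff mt 1 \<in> two_cocycles sA sL act m \<and>
    (\<forall>n\<ge>1. (\<forall>i. 1 \<le> i \<and> i \<le> n - 1 \<longrightarrow> deformation_coeff mt i = (\<lambda>x y. 0)) \<longrightarrow>
       deformation_coeff mt n \<noteq> (\<lambda>x y. 0) \<longrightarrow>
       deformation_coeff mt n \<in> two_cocycles sA sL act m)"
proof -
  have *: "deformation_coeff mt n \<in> two_cocycles sA sL act m"
    if "n \<ge> 1" "\<And>i. 0 < i \<Longrightarrow> i < n \<Longrightarrow> deformation_coeff mt i = (\<lambda>x y. 0)" for n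
    using assms(2) coboundary_n_infinitesimal[OF assms that]
    by (simp add: two_cocycles_def deformation_def)
  show ?thesis
  proof (intro conjI allI impI)
    show "deformation_coeff mt 1 \<in> two_cocycles sA sL act m"
      \<comment> \<open>No \<open>i\<close> satisfies 0 < i < 1, so the vanishing condition holds
        vacuously.\<close>
      by (rule *) auto
  next
    fix n :: nat
    assume "n \<ge> 1" and "\<forall>i. 1 \<le> i \<and> i \<le> n - 1 \<longrightarrow> deformation_coeff mt i = (\<lambda>x y. 0)"
    then show "deformation_coeff mt n \<in> two_cocycles sA sL act m"
      by (intro *) simp_all
  qed
qed

end
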